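(* Let $G=(V,E)$ be a finite connected simple graph with $E\ne\varnothing$ and girth at least $6$, and let $H\subsetneq G$ be a densest core (a proper subgraph of $G$ that is a densest core). Put $$t_*:=\frac{|V(H)|}{|E(H)|}=\frac{2}{\operatorname{mad}(G)}.$$ For a positive edge weight $w$, set $\lambda(w):=\min_{e\in E}q_e^w$. Then, for every positive edge weight $w$, $$0<L_H(w)\le |E(H)|\bigl(t_*-\lambda(w)\bigr).$$ Consequently, if $\{w^{(j)}\}$ is a maximizing sequence for $\kappa_{\max}^{\mathrm{LLY}}(G)$, then $L_H(w^{(j)})\to0$ and $q_e^{w^{(j)}}\to t_*$ for every $e\in E(H)$.
   Context: Graphs are finite, simple and undirected. The girth is the length of a shortest cycle, and $\infty$ for a tree. The maximum average degree is $\operatorname{mad}(G):=\max_{\varnothing\ne H\subseteq G}\frac{2|E(H)|}{|V(H)|}$, the maximum being over nonempty subgraphs $H$ of $G$. A nonempty subgraph $H\subseteq G$ is a densest core if $\frac{2|E(H)|}{|V(H)|}=\operatorname{mad}(G)$. Lin--Lu--Yau curvature with fixed combinatorial distance: let $G=(V,E)$ be finite and connected with $E\neq\varnothing$, and let $d$ be its combinatorial (shortest-path) distance. A positive edge weight is a function $w:E\to(0,\infty)$; put $d_x^w:=\sum_{z\sim x}w_{xz}$. For $\alpha\in[0,1]$ and $x\in V$ let $\mu_x^{\alpha,w}$ be the probability measure on $V$ with $\mu_x^{\alpha,w}(x)=\alpha$, $\mu_x^{\alpha,w}(z)=(1-\alpha)w_{xz}/d_x^w$ if $z\sim x$, and $\mu_x^{\alpha,w}(z)=0$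 otherwise. Let $W_1$ be the $1$-Wasserstein distance with respect to $d$ (independent of $w$). For an edge $e=xy$, put $\kappa_\alpha^w(x,y):=1-W_1(\mu_x^{\alpha,w},\mu_y^{\alpha,w})$ and $$\kappa_{\mathrm{LLY}}^w(e)=\kappa_{\mathrm{LLY}}^w(x,y):=\lim_{\alpha\to1^-}\frac{\kappa_\alpha^w(x,y)}{1-\alpha}.$$ Put $\kappa_{\mathrm{LLY}}^w(G):=\min_{e\in E}\kappa_{\mathrm{LLY}}^w(e)$ and $\kappa_{\max}^{\mathrm{LLY}}(G):=\sup_{w:E\to(0,\infty)}\kappa_{\mathrm{LLY}}^w(G)$. A maximizing sequence is a sequence of positive edge weights $w^{(j)}$ with $\kappa_{\mathrm{LLY}}^{w^{(j)}}(G)\to\kappa_{\max}^{\mathrm{LLY}}(G)$. For an edge $e=xy$, $q_e^w:=\frac{w_{xy}}{d_x^w}+\frac{w_{xy}}{d_y^w}$. For a nonempty subgraph $H\subseteq G$, the leakage is $L_H(w):=\sum_{x\in V(H)}\sum_{e\ni x,\ e\notin E(H)}\frac{w_e}{d_x^w}$, where $e$ ranges over edges of $G$. *)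

theory Defs
  imports "HOL-Probability.Probability_Mass_Function" "HOL-Library.Extended_Nat"
begin

definition simple_graph :: "'a set \<Rightarrow> 'a set set \<Rightarrow> bool" where
  "simple_graph V E \<longleftrightarrow> finite V \<and> (\<forall>e\<in>E. e \<subseteq> V \<and> card e = 2)"

text \<open>Walks and cycles are given by their lists of vertices, so a walk with \<open>n\<close> edges has
  \<open>n + 1\<close> entries, whereas a cycle (its first vertex is not repeated) has as many entries as edges.\<close>

definition is_walk :: "'a set \<Rightarrow> 'a set set \<Rightarrow> 'a list \<Rightarrow> bool" where
  "is_walk V E p \<longleftrightarrow> p \<noteq> [] \<and> set p \<subseteq> V \<and> successively (\<lambda>x y. {x, y} \<in> E) p"

definition connected_graph :: "'a set \<Rightarrow> 'a set set \<Rightarrow> bool" where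
  "connected_graph V E \<longleftrightarrow>
     V \<noteq> {} \<and> (\<forall>x\<in>V. \<forall>y\<in>V. \<exists>p. is_walk V E p \<and> hd p = x \<and> last p = y)"

definition graph_dist :: "'a set \<Rightarrow> 'a set set \<Rightarrow> 'a \<Rightarrow> 'a \<Rightarrow> nat" where
  "graph_dist V E x y =
     (LEAST n. \<exists>p. is_walk V E p \<and> hd p = x \<and> last p = y \<and> length p = Suc n)"

definition is_cycle :: "'a set \<Rightarrow> 'a set set \<Rightarrow> 'a list \<Rightarrow> bool" where
  "is_cycle V E p \<longleftrightarrow> is_walk V E p \<and> 3 \<le> length p \<and> distinct p \<and> {last p, hd p} \<in> E"

definition girth :: "'a set \<Rightarrow> 'a set set \<Rightarrow> enat" where
  "girth V E = (INF p \<in> {p. is_cycle V E p}. enat (length p))"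

definition subgraph :: "'a set \<Rightarrow> 'a set set \<Rightarrow> 'a set \<Rightarrow> 'a set set \<Rightarrow> bool" where
  "subgraph VH EH V E \<longleftrightarrow> simple_graph VH EH \<and> VH \<subseteq> V \<and> EH \<subseteq> E"

definition mad :: "'a set \<Rightarrow> 'a set set \<Rightarrow> real" where
  "mad V E = Max {2 * real (card EH) / real (card VH) | VH EH. subgraph VH EH V E \<and> VH \<noteq> {}}"

definition densest_core :: "'a set \<Rightarrow> 'a set set \<Rightarrow> 'a set \<Rightarrow> 'a set set \<Rightarrow> bool" where
  "densest_core VH EH V E \<longleftrightarrow>
     subgraph VH EH V E \<and> VH \<noteq> {} \<and> 2 * real (card EH) / real (card VH) = mad V E"

text \<open>Edge weights are total functions on vertex sets; only their values on \<open>E\<close> are ever used.\<close>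

definition positive_weight :: "'a set set \<Rightarrow> ('a set \<Rightarrow> real) \<Rightarrow> bool" where
  "positive_weight E w \<longleftrightarrow> (\<forall>e\<in>E. 0 < w e)"

definition wdeg :: "'a set set \<Rightarrow> ('a set \<Rightarrow> real) \<Rightarrow> 'a \<Rightarrow> real" where
  "wdeg E w x = (\<Sum>z | {x, z} \<in> E. w {x, z})"

definition mu_mass :: "'a set set \<Rightarrow> ('a set \<Rightarrow> real) \<Rightarrow> real \<Rightarrow> 'a \<Rightarrow> 'a \<Rightarrow> real" where
  "mu_mass E w \<alpha> x z =
     (if z = x then \<alpha> else if {x, z} \<in> E then (1 - \<alpha>) * w {x, z} / wdeg E w x else 0)"

definition mu :: "'a set set \<Rightarrow> ('a set \<Rightarrow> real) \<Rightarrow> real \<Rightarrow> 'a \<Rightarrow> 'a pmf" where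
  "mu E w \<alpha> x = embed_pmf (mu_mass E w \<alpha> x)"

text \<open>\<open>embed_pmf\<close> is unspecified unless the masses are nonnegative and sum to one, which holds
  at every non-isolated vertex.\<close>

lemma pmf_mu:
  assumes G: "simple_graph V E" and w: "positive_weight E w"
    and \<alpha>: "0 \<le> \<alpha>" "\<alpha> \<le> 1" and x: "{x, y} \<in> E"
  shows "pmf (mu E w \<alpha> x) z = mu_mass E w \<alpha> x z"
proof -
  let ?N = "{z. {x, z} \<in> E}"
  have "?N \<subseteq> V" using G by (auto simp: simple_graph_def)
  then have fin: "finite ?N" using G by (auto simp: simple_graph_def intro: finite_subset)
  have xN: "x \<notin> ?N" using G by (auto simp: simple_graph_def)
  have pos: "0 < w {x, z}" if "z \<in> ?N" for z
    using w that by (auto simp: positive_weight_def)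
  have deg: "0 < wdeg E w x"
    unfolding wdeg_def using fin pos x by (intro sum_pos) auto
  have nonneg: "0 \<le> mu_mass E w \<alpha> x z" for z
    using \<alpha> deg pos[of z] by (auto simp: mu_mass_def intro!: divide_nonneg_pos mult_nonneg_nonneg)
  have "(\<Sum>z\<in>?N. mu_mass E w \<alpha> x z) = (\<Sum>z\<in>?N. (1 - \<alpha>) * w {x, z} / wdeg E w x)"
    using xN by (intro sum.cong) (auto simp: mu_mass_def)
  also have "\<dots> = (1 - \<alpha>) * (wdeg E w x / wdeg E w x)"
    by (simp only: sum_divide_distrib[symmetric] sum_distrib_left[symmetric]
        wdeg_def[symmetric] times_divide_eq_right)
  also have "\<dots> = 1 - \<alpha>" using deg by simp
  finally have one: "(\<Sum>z\<in>insert x ?N. mu_mass E w \<alpha> x z) = 1"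
    using fin xN by (simp add: mu_mass_def)
  have "(\<integral>\<^sup>+ z. ennreal (mu_mass E w \<alpha> x z) \<partial>count_space UNIV)
      = (\<Sum>z\<in>insert x ?N. ennreal (mu_mass E w \<alpha> x z))"
    using fin by (intro nn_integral_count_space') (auto simp: mu_mass_def)
  also have "\<dots> = 1"
    using nonneg one by (simp add: sum_ennreal del: sum.insert)
  finally show ?thesis
    unfolding mu_def by (intro pmf_embed_pmf nonneg)
qed

definition wasserstein1 :: "('a \<Rightarrow> 'a \<Rightarrow> real) \<Rightarrow> 'a pmf \<Rightarrow> 'a pmf \<Rightarrow> real" where
  "wasserstein1 d \<mu> \<nu> =
     (INF \<gamma> \<in> {\<gamma>. map_pmf fst \<gamma> = \<mu> \<and> map_pmf snd \<gamma> = \<nu>}.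
        measure_pmf.expectation \<gamma> (\<lambda>(a, b). d a b))"

definition kappa_alpha ::
    "'a set \<Rightarrow> 'a set set \<Rightarrow> ('a set \<Rightarrow> real) \<Rightarrow> real \<Rightarrow> 'a \<Rightarrow> 'a \<Rightarrow> real" where
  "kappa_alpha V E w \<alpha> x y =
     1 - wasserstein1 (\<lambda>a b. real (graph_dist V E a b)) (mu E w \<alpha> x) (mu E w \<alpha> y)"

definition kappa_LLY :: "'a set \<Rightarrow> 'a set set \<Rightarrow> ('a set \<Rightarrow> real) \<Rightarrow> 'a \<Rightarrow> 'a \<Rightarrow> real" where
  "kappa_LLY V E w x y = Lim (at_left 1) (\<lambda>\<alpha>. kappa_alpha V E w \<alpha> x y / (1 - \<alpha>))"

text \<open>The minimum runs over ordered pairs of adjacent vertices; as \<open>kappa_LLY\<close> is symmetric in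
  its endpoints, this is the minimum over edges.\<close>

definition kappa_LLY_graph :: "'a set \<Rightarrow> 'a set set \<Rightarrow> ('a set \<Rightarrow> real) \<Rightarrow> real" where
  "kappa_LLY_graph V E w = Min {kappa_LLY V E w x y | x y. {x, y} \<in> E}"

definition kappa_max_LLY :: "'a set \<Rightarrow> 'a set set \<Rightarrow> real" where
  "kappa_max_LLY V E = (SUP w \<in> {w. positive_weight E w}. kappa_LLY_graph V E w)"

definition maximizing_sequence ::
    "'a set \<Rightarrow> 'a set set \<Rightarrow> (nat \<Rightarrow> 'a set \<Rightarrow> real) \<Rightarrow> bool" where
  "maximizing_sequence V E W \<longleftrightarrow>
     (\<forall>j. positive_weight E (W j)) \<and>
     (\<lambda>j. kappa_LLY_graph V E (W j)) \<longlonglongrightarrow> kappa_max_LLY V E"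

text \<open>For an edge \<open>e = {x, y}\<close> the sum has exactly the two terms at \<open>x\<close> and \<open>y\<close>.\<close>

definition q_edge :: "'a set set \<Rightarrow> ('a set \<Rightarrow> real) \<Rightarrow> 'a set \<Rightarrow> real" where
  "q_edge E w e = (\<Sum>x\<in>e. w e / wdeg E w x)"

definition lambda_min :: "'a set set \<Rightarrow> ('a set \<Rightarrow> real) \<Rightarrow> real" where
  "lambda_min E w = Min (q_edge E w ` E)"

definition leakage :: "'a set set \<Rightarrow> 'a set \<Rightarrow> 'a set set \<Rightarrow> ('a set \<Rightarrow> real) \<Rightarrow> real" where
  "leakage E VH EH w = (\<Sum>x\<in>VH. \<Sum>e | e \<in> E \<and> x \<in> e \<and> e \<notin> EH. w e / wdeg E w x)"

end

theory Submission
  imports Defs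
begin

text \<open>
  Every vertex \<open>x\<close> splits one unit of mass over its incident edges, giving \<open>w e / wdeg E w x\<close> to
  \<open>e\<close>, and \<open>q_edge E w e\<close> is what \<open>e\<close> receives from its two ends. The edges of a subgraph
  \<open>(VH, EH)\<close> therefore receive exactly \<open>card VH\<close> minus the leakage
  (\<open>sum_q_edge_plus_leakage\<close>). As each of them receives at least \<open>lambda_min E w\<close>, and
  \<open>card VH = t * card EH\<close>, the upper bound on the leakage follows. The leakage is positive because
  a connected graph has an edge outside \<open>EH\<close> at some vertex of the proper subgraph.

  For a maximizing sequence it suffices to know that \<open>lambda_min\<close> converges to \<open>t\<close>: then the leakage
  is squeezed to zero, and each \<open>q_edge\<close> on the core is squeezed as well, since it exceeds the
  minimum by at most the total excess over the core. This needs two facts.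

  First, in girth at least six, \<open>kappa_LLY V E w x y = 2 * q_edge E w {x, y} - 2\<close>
  (\<open>kappa_LLY_eq\<close>). The other neighbours of \<open>x\<close> lie at distance 3 from those of \<open>y\<close>, so the
  potential with value 2 on the former, 1 at \<open>x\<close>, 0 at \<open>y\<close> and \<open>-1\<close> on the latter is a Kantorovich
  potential; a coupling that leaves the common mass in place transports only along pairs on which
  this potential drops by exactly the distance.

  Second, some weights have \<open>lambda_min\<close> arbitrarily close to \<open>t\<close>
  (\<open>exists_weight_lambda_min_gt\<close>), so that the supremum of the curvatures is \<open>2 * t - 2\<close>. In the
  variables \<open>ln (w e)\<close>, the function
  \<open>log_potential t w = (\<Sum>x\<in>V. ln (1 + wdeg E w x)) - t * (\<Sum>e\<in>E. ln (w e))\<close> has partial derivatives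
  \<open>(\<Sum>x\<in>e. w e / (1 + wdeg E w x)) - t \<le> q_edge E w e - t\<close>. It is bounded below because
  no subgraph has more than \<open>1 / t\<close> edges per vertex (\<open>log_potential_nonneg\<close>), and at a
  near-minimizer no partial derivative can be very negative.
\<close>

section \<open>Weighted degrees and double counting\<close>

locale nonempty_connected_graph =
  fixes V :: "'a set" and E :: "'a set set"
  assumes simple: "simple_graph V E"
    and connected: "connected_graph V E"
    and nonempty: "E \<noteq> {}"
begin

lemma finite_V: "finite V"
  using simple by (simp add: simple_graph_def)

lemma edge_subset: "e \<in> E \<Longrightarrow> e \<subseteq> V"
  using simple by (simp add: simple_graph_def)

lemma finite_E: "finite E"
proof (rule finite_subset)
  show "E \<subseteq> Pow V" using edge_subset by blast
qed (simp add: finite_V)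

lemma edge_endpoints:
  assumes "e \<in> E"
  obtains x y where "e = {x, y}" "x \<noteq> y"
  using assms simple by (auto simp: simple_graph_def card_2_iff)

lemma edge_distinct: "{x, y} \<in> E \<Longrightarrow> x \<noteq> y"
  using simple by (auto simp: simple_graph_def)

lemma edge_vertices: "{x, y} \<in> E \<Longrightarrow> x \<in> V \<and> y \<in> V"
  using edge_subset by blast

lemma finite_neighbours: "finite {z. {x, z} \<in> E}"
  by (rule finite_subset[OF _ finite_V]) (use edge_vertices in blast)

text \<open>A walk from inside \<open>U\<close> to outside has to cross somewhere.\<close>

lemma edge_boundary:
  assumes "U \<subseteq> V" "U \<noteq> {}" "U \<noteq> V"
  obtains x y where "{x, y} \<in> E" "x \<in> U" "y \<notin> U"
proof -
  obtain a b where ab: "a \<in> U" "b \<in> V" "b \<notin> U" using assms by blast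
  then obtain p where p: "is_walk V E p" "hd p = a" "last p = b"
    using connected assms(1) unfolding connected_graph_def by blast
  have "\<exists>x y. {x, y} \<in> E \<and> x \<in> U \<and> y \<notin> U"
    if "p \<noteq> []" "successively (\<lambda>x y. {x, y} \<in> E) p" "hd p \<in> U" "last p \<notin> U" for p
    using that
  proof (induction p)
    case (Cons c p)
    show ?case
    proof (cases p)
      case Nil
      then show ?thesis using Cons.prems by simp
    next
      case (Cons d r)
      then show ?thesis using Cons.prems Cons.IH by (cases "d \<in> U") auto
    qed
  qed simp
  then show ?thesis using p ab that unfolding is_walk_def by blast
qed

lemma exists_incident_edge:
  assumes "x \<in> V"
  obtains y where "{x, y} \<in> E"
proof (cases "V = {x}")
  case True
  obtain e where "e \<in> E" using nonempty by blast
  then obtain a b where "e = {a, b}" "a \<noteq> b" by (rule edge_endpoints)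
  then show ?thesis using True \<open>e \<in> E\<close> edge_subset by blast
next
  case False
  then obtain u y where "{u, y} \<in> E" "u \<in> {x}" using edge_boundary[of "{x}"] assms by blast
  then show ?thesis using that by blast
qed

lemma wdeg_eq_sum_incident: "wdeg E w x = (\<Sum>e | e \<in> E \<and> x \<in> e. w e)"
proof -
  have "bij_betw (\<lambda>z. {x, z}) {z. {x, z} \<in> E} {e. e \<in> E \<and> x \<in> e}"
    unfolding bij_betw_def
  proof
    show "inj_on (\<lambda>z. {x, z}) {z. {x, z} \<in> E}" by (auto simp: inj_on_def doubleton_eq_iff)
    show "(\<lambda>z. {x, z}) ` {z. {x, z} \<in> E} = {e. e \<in> E \<and> x \<in> e}"
    proof (intro equalityI subsetI)
      fix e assume e: "e \<in> {e. e \<in> E \<and> x \<in> e}"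
      then obtain a b where "e = {a, b}" using edge_endpoints by blast
      with e show "e \<in> (\<lambda>z. {x, z}) ` {z. {x, z} \<in> E}" by (auto simp: insert_commute)
    qed auto
  qed
  then show ?thesis unfolding wdeg_def by (rule sum.reindex_bij_betw)
qed

lemma wdeg_pos:
  assumes "positive_weight E w" "x \<in> V"
  shows "0 < wdeg E w x"
proof -
  obtain y where "{x, y} \<in> E" using assms(2) by (rule exists_incident_edge)
  then show ?thesis unfolding wdeg_def
    using assms(1) finite_neighbours by (intro sum_pos) (auto simp: positive_weight_def)
qed

lemma q_edge_doubleton:
  assumes "{x, y} \<in> E"
  shows "q_edge E w {x, y} = w {x, y} / wdeg E w x + w {x, y} / wdeg E w y"
  using edge_distinct[OF assms] by (simp add: q_edge_def)

lemma lambda_min_le: "e \<in> E \<Longrightarrow> lambda_min E w \<le> q_edge E w e"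
  unfolding lambda_min_def using finite_E by (intro Min_le) auto

text \<open>Every vertex distributes total mass one over its incident edges, and \<open>q_edge\<close> collects
  what an edge receives. Hence the edges of a subgraph receive all mass of its vertices except for
  what leaks out through the other edges.\<close>

lemma sum_q_edge_plus_leakage:
  assumes sub: "subgraph U F V E" and w: "positive_weight E w"
  shows "(\<Sum>e\<in>F. q_edge E w e) + leakage E U F w = real (card U)"
proof -
  have FE: "F \<subseteq> E" and UV: "U \<subseteq> V" and FU: "\<And>e. e \<in> F \<Longrightarrow> e \<subseteq> U"
    using sub by (auto simp: subgraph_def simple_graph_def)
  have finF: "finite F" and finU: "finite U"
    using FE UV finite_E finite_V finite_subset by blast+
  have "(\<Sum>e\<in>F. q_edge E w e) = (\<Sum>e\<in>F. \<Sum>x | x \<in> U \<and> x \<in> e. w e / wdeg E w x)"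
    unfolding q_edge_def using FU by (intro sum.cong) auto
  also have "\<dots> = (\<Sum>x\<in>U. \<Sum>e | e \<in> F \<and> x \<in> e. w e / wdeg E w x)"
    using finF finU by (rule sum.swap_restrict)
  finally have "(\<Sum>e\<in>F. q_edge E w e) + leakage E U F w =
      (\<Sum>x\<in>U. (\<Sum>e | e \<in> F \<and> x \<in> e. w e / wdeg E w x) +
               (\<Sum>e | e \<in> E \<and> x \<in> e \<and> e \<notin> F. w e / wdeg E w x))"
    by (simp add: leakage_def sum.distrib)
  also have "\<dots> = (\<Sum>x\<in>U. 1)"
  proof (rule sum.cong[OF refl])
    fix x assume "x \<in> U"
    have "(\<Sum>e | e \<in> F \<and> x \<in> e. w e / wdeg E w x) +
          (\<Sum>e | e \<in> E \<and> x \<in> e \<and> e \<notin> F. w e / wdeg E w x) =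
          (\<Sum>e\<in>{e. e \<in> F \<and> x \<in> e} \<union> {e. e \<in> E \<and> x \<in> e \<and> e \<notin> F}. w e / wdeg E w x)"
      using finF finite_E by (intro sum.union_disjoint[symmetric]) auto
    also have "{e. e \<in> F \<and> x \<in> e} \<union> {e. e \<in> E \<and> x \<in> e \<and> e \<notin> F} = {e. e \<in> E \<and> x \<in> e}"
      using FE by blast
    also have "(\<Sum>e | e \<in> E \<and> x \<in> e. w e / wdeg E w x) = wdeg E w x / wdeg E w x"
      by (simp only: wdeg_eq_sum_incident[of w x] sum_divide_distrib)
    also have "\<dots> = 1" using wdeg_pos[OF w, of x] \<open>x \<in> U\<close> UV by auto
    finally show "(\<Sum>e | e \<in> F \<and> x \<in> e. w e / wdeg E w x) +
          (\<Sum>e | e \<in> E \<and> x \<in> e \<and> e \<notin> F. w e / wdeg E w x) = 1" .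
  qed
  finally show ?thesis by simp
qed

text \<open>A proper subgraph misses an edge at one of its vertices: if it spans all vertices, any missing
  edge will do, and otherwise connectedness provides an edge that leaves its vertex set.\<close>

lemma leakage_pos:
  assumes sub: "subgraph U F V E" and U: "U \<noteq> {}" and proper: "(U, F) \<noteq> (V, E)"
    and w: "positive_weight E w"
  shows "0 < leakage E U F w"
proof -
  have FE: "F \<subseteq> E" and UV: "U \<subseteq> V" and FU: "\<And>e. e \<in> F \<Longrightarrow> e \<subseteq> U"
    using sub by (auto simp: subgraph_def simple_graph_def)
  have finU: "finite U" using UV finite_V finite_subset by blast
  have "\<exists>x e. x \<in> U \<and> e \<in> E \<and> x \<in> e \<and> e \<notin> F"
  proof (cases "U = V")
    case True
    then obtain e where e: "e \<in> E" "e \<notin> F" using proper FE by blast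
    obtain x y where "e = {x, y}" using e(1) by (rule edge_endpoints)
    then show ?thesis using e True edge_subset by blast
  next
    case False
    then obtain x y where xy: "{x, y} \<in> E" "x \<in> U" "y \<notin> U" using edge_boundary UV U by blast
    then have "{x, y} \<notin> F" using FU by blast
    then show ?thesis using xy by blast
  qed
  then obtain x e where xe: "x \<in> U" "e \<in> E" "x \<in> e" "e \<notin> F" by blast
  have pos: "0 < w e' / wdeg E w z" if "z \<in> U" "e' \<in> E" for z e'
    using that w wdeg_pos[OF w, of z] UV by (auto simp: positive_weight_def)
  have fin: "finite {e. e \<in> E \<and> z \<in> e \<and> e \<notin> F}" for z using finite_E by simp
  show ?thesis
    unfolding leakage_def
  proof (rule sum_pos2[OF finU xe(1)])
    show "0 < (\<Sum>e | e \<in> E \<and> x \<in> e \<and> e \<notin> F. w e / wdeg E w x)"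
      using pos xe fin by (intro sum_pos) auto
    show "0 \<le> (\<Sum>e | e \<in> E \<and> z \<in> e \<and> e \<notin> F. w e / wdeg E w z)" if "z \<in> U" for z
      using pos[OF that] by (intro sum_nonneg) (auto intro: less_imp_le)
  qed
qed

lemma leakage_upper_bound:
  assumes "subgraph U F V E" "positive_weight E w"
  shows "leakage E U F w \<le> real (card U) - real (card F) * lambda_min E w"
proof -
  have "real (card F) * lambda_min E w \<le> (\<Sum>e\<in>F. q_edge E w e)"
    using assms(1) by (intro sum_bounded_below lambda_min_le) (auto simp: subgraph_def)
  then show ?thesis using sum_q_edge_plus_leakage[OF assms] by linarith
qed

end

section \<open>Weights with all edge masses close to the optimum\<close>

text \<open>This is a layer-cake argument. If \<open>v\<close> is the indicator of an edge set \<open>F\<close>, then \<open>g\<close> is at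
  least one on the vertices covered by \<open>F\<close>, and the claim is the sparsity condition for \<open>F\<close>. In
  general \<open>v\<close> is a positive combination of indicators of its superlevel sets; the induction peels
  off the lowest layer, which is the support of \<open>v\<close>, and subtracts the same height from \<open>g\<close> on the
  covered vertices.\<close>

lemma sum_le_sum_of_dominating:
  fixes v :: "'a set \<Rightarrow> real" and g :: "'a \<Rightarrow> real"
  assumes "finite V" "finite E" "\<Union>E \<subseteq> V"
    and sparse: "\<And>F. F \<subseteq> E \<Longrightarrow> t * real (card F) \<le> real (card (\<Union>F))"
    and "\<And>e. e \<in> E \<Longrightarrow> 0 \<le> v e" "\<And>x. x \<in> V \<Longrightarrow> 0 \<le> g x"
    and "\<And>e x. e \<in> E \<Longrightarrow> x \<in> e \<Longrightarrow> v e \<le> g x"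
  shows "t * (\<Sum>e\<in>E. v e) \<le> (\<Sum>x\<in>V. g x)"
  using assms(5-7)
proof (induction "card {e \<in> E. 0 < v e}" arbitrary: v g rule: less_induct)
  case less
  define F where "F = {e \<in> E. 0 < v e}"
  have FE: "F \<subseteq> E" and finF: "finite F" using \<open>finite E\<close> by (auto simp: F_def)
  show ?case
  proof (cases "F = {}")
    case True
    then have "v e = 0" if "e \<in> E" for e using that less.prems(1)[of e] by (force simp: F_def)
    then show ?thesis using less.prems(2) by (simp add: sum_nonneg)
  next
    case False
    define m where "m = Min (v ` F)"
    have m_le: "m \<le> v e" if "e \<in> F" for e using that finF by (simp add: m_def)
    have "m \<in> v ` F" using finF False by (auto simp: m_def)
    then obtain e0 where e0: "e0 \<in> F" "v e0 = m" by auto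
    then have m_pos: "0 < m" by (auto simp: F_def)
    define v' where "v' e = (if e \<in> F then v e - m else v e)" for e
    define g' where "g' x = (if x \<in> \<Union>F then g x - m else g x)" for x
    have "t * (\<Sum>e\<in>E. v' e) \<le> (\<Sum>x\<in>V. g' x)"
    proof (rule less.hyps)
      have "{e \<in> E. 0 < v' e} \<subset> F"
        using e0 FE by (auto simp: v'_def F_def split: if_splits)
      then show "card {e \<in> E. 0 < v' e} < card {e \<in> E. 0 < v e}"
        using finF psubset_card_mono unfolding F_def by blast
      show "0 \<le> v' e" if "e \<in> E" for e using that m_le less.prems(1) by (auto simp: v'_def)
      show g'_nonneg: "0 \<le> g' x" if "x \<in> V" for x
        using that less.prems(2) order_trans[OF m_le less.prems(3)] FE by (auto simp: g'_def)
      show "v' e \<le> g' x" if "e \<in> E" "x \<in> e" for e x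
      proof (cases "e \<in> F")
        case True
        then show ?thesis using that less.prems(3)[OF that] by (auto simp: v'_def g'_def)
      next
        case eF: False
        then have "v e = 0" using that less.prems(1)[of e] by (force simp: F_def)
        then show ?thesis using eF that \<open>\<Union>E \<subseteq> V\<close> g'_nonneg[of x] by (auto simp: v'_def)
      qed
    qed
    moreover have "(\<Sum>e\<in>E. v e) = (\<Sum>e\<in>E. v' e) + m * real (card F)"
    proof -
      have "(\<Sum>e\<in>E. v e) = (\<Sum>e\<in>E. v' e + (if e \<in> F then m else 0))"
        by (intro sum.cong) (auto simp: v'_def)
      then show ?thesis using \<open>finite E\<close> FE
        by (simp add: sum.distrib sum.If_cases Int_absorb1)
    qed
    moreover have "(\<Sum>x\<in>V. g x) = (\<Sum>x\<in>V. g' x) + m * real (card (\<Union>F))"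
    proof -
      have "(\<Sum>x\<in>V. g x) = (\<Sum>x\<in>V. g' x + (if x \<in> \<Union>F then m else 0))"
        by (intro sum.cong) (auto simp: g'_def)
      moreover have "V \<inter> \<Union>F = \<Union>F" using FE \<open>\<Union>E \<subseteq> V\<close> by blast
      ultimately show ?thesis using \<open>finite V\<close>
        by (simp add: sum.distrib sum.If_cases del: Union_iff)
    qed
    moreover have "m * (t * real (card F)) \<le> m * real (card (\<Union>F))"
      using sparse[OF FE] m_pos by (intro mult_left_mono) auto
    ultimately show ?thesis by (simp add: algebra_simps)
  qed
qed

context nonempty_connected_graph
begin

text \<open>The summand 1 inside the logarithm keeps the function bounded below also when the weights tend
  to zero: scaling all weights would otherwise change it by a multiple of \<open>card V - t * card E\<close>, which
  need not vanish.\<close>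

definition log_potential :: "real \<Rightarrow> ('a set \<Rightarrow> real) \<Rightarrow> real" where
  "log_potential t w = (\<Sum>x\<in>V. ln (1 + wdeg E w x)) - t * (\<Sum>e\<in>E. ln (w e))"

text \<open>\<open>ln (1 + wdeg E w x)\<close> dominates both 0 and \<open>ln (w e)\<close> for every edge \<open>e\<close> at \<open>x\<close>.\<close>

lemma log_potential_nonneg:
  assumes t: "0 \<le> t" and w: "positive_weight E w"
    and sparse: "\<And>F. F \<subseteq> E \<Longrightarrow> t * real (card F) \<le> real (card (\<Union>F))"
  shows "0 \<le> log_potential t w"
proof -
  have "t * (\<Sum>e\<in>E. ln (w e)) \<le> t * (\<Sum>e\<in>E. max 0 (ln (w e)))"
    using t by (intro mult_left_mono sum_mono) auto
  also have "\<dots> \<le> (\<Sum>x\<in>V. ln (1 + wdeg E w x))"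
  proof (rule sum_le_sum_of_dominating[OF finite_V finite_E _ sparse])
    show "\<Union>E \<subseteq> V" using edge_subset by blast
    show nonneg: "0 \<le> ln (1 + wdeg E w x)" if "x \<in> V" for x
      using wdeg_pos[OF w that] by simp
    show "max 0 (ln (w e)) \<le> ln (1 + wdeg E w x)" if "e \<in> E" "x \<in> e" for e x
    proof -
      have "w e \<le> wdeg E w x"
        unfolding wdeg_eq_sum_incident using that w finite_E
        by (intro member_le_sum) (auto simp: positive_weight_def intro: less_imp_le)
      moreover have "0 < w e" using w that by (simp add: positive_weight_def)
      ultimately have "ln (w e) \<le> ln (1 + wdeg E w x)" by simp
      then show ?thesis using nonneg that edge_subset by auto
    qed
  qed auto
  finally show ?thesis by (simp add: log_potential_def)
qed

text \<open>The finite-step form of the bound \<open>q_edge E w e - t\<close> for the logarithmic derivative along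
  \<open>e\<close>. Only the degrees at the two ends of \<open>e\<close> change, and \<open>ln (1 + u) \<le> u\<close>.\<close>

lemma log_potential_scale_edge:
  assumes w: "positive_weight E w" and e: "e \<in> E" and s: "0 < s"
  shows "log_potential t (w(e := (1 + s) * w e))
       \<le> log_potential t w + s * q_edge E w e - t * ln (1 + s)"
proof -
  let ?w = "w(e := (1 + s) * w e)"
  have we: "0 < w e" using w e by (simp add: positive_weight_def)
  have deg: "wdeg E ?w x = wdeg E w x + (if x \<in> e then s * w e else 0)" for x
  proof -
    have "wdeg E ?w x = (\<Sum>f | f \<in> E \<and> x \<in> f. w f + (if f = e then s * w e else 0))"
      unfolding wdeg_eq_sum_incident by (intro sum.cong) (auto simp: algebra_simps)
    then show ?thesis
      using finite_E e by (simp add: sum.distrib wdeg_eq_sum_incident)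
  qed
  have "ln (1 + wdeg E ?w x) \<le> ln (1 + wdeg E w x) + (if x \<in> e then s * (w e / wdeg E w x) else 0)"
    if x: "x \<in> V" for x
  proof (cases "x \<in> e")
    case True
    have d: "0 < wdeg E w x" by (rule wdeg_pos[OF w x])
    have "1 + wdeg E ?w x = (1 + wdeg E w x) * (1 + s * w e / (1 + wdeg E w x))"
      using d by (simp only: deg True if_True) (simp add: field_simps)
    then have "ln (1 + wdeg E ?w x) = ln (1 + wdeg E w x) + ln (1 + s * w e / (1 + wdeg E w x))"
      using d s we by (simp add: ln_mult_pos add_pos_pos)
    also have "ln (1 + s * w e / (1 + wdeg E w x)) \<le> s * w e / (1 + wdeg E w x)"
      using d s we by (intro ln_add_one_self_le_self) simp
    also have "\<dots> \<le> s * w e / wdeg E w x"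
      using d s we by (intro divide_left_mono) auto
    finally show ?thesis using True by simp
  qed (simp add: deg)
  then have "(\<Sum>x\<in>V. ln (1 + wdeg E ?w x)) \<le>
      (\<Sum>x\<in>V. ln (1 + wdeg E w x) + (if x \<in> e then s * (w e / wdeg E w x) else 0))"
    by (intro sum_mono)
  also have "\<dots> = (\<Sum>x\<in>V. ln (1 + wdeg E w x)) + s * q_edge E w e"
    using finite_V edge_subset[OF e]
    by (simp add: sum.distrib sum.If_cases Int_absorb1 q_edge_def sum_distrib_left)
  finally have "(\<Sum>x\<in>V. ln (1 + wdeg E ?w x)) \<le> (\<Sum>x\<in>V. ln (1 + wdeg E w x)) + s * q_edge E w e" .
  moreover have "(\<Sum>f\<in>E. ln (?w f)) = (\<Sum>f\<in>E. ln (w f)) + ln (1 + s)"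
  proof -
    have "(\<Sum>f\<in>E. ln (?w f)) = (\<Sum>f\<in>E. ln (w f) + (if f = e then ln (1 + s) else 0))"
      using we s by (intro sum.cong) (auto simp: ln_mult_pos)
    then show ?thesis using finite_E e by (simp add: sum.distrib)
  qed
  ultimately show ?thesis by (simp add: log_potential_def algebra_simps)
qed

text \<open>At a weight within \<open>s\<^sup>2\<close> of the infimum, scaling one edge by \<open>1 + s\<close> lowers the
  potential by less than \<open>s\<^sup>2\<close>, but raises it by at most \<open>s * q_edge E w e - t * ln (1 + s)\<close>. Dividing
  by \<open>s\<close> gives \<open>q_edge E w e > t - (t + 1) * s\<close>. The infimum need not be attained, so an exact
  minimizer is not available.\<close>

lemma exists_weight_lambda_min_gt:
  assumes t: "0 \<le> t" and \<epsilon>: "0 < \<epsilon>"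
    and sparse: "\<And>F. F \<subseteq> E \<Longrightarrow> t * real (card F) \<le> real (card (\<Union>F))"
  obtains w where "positive_weight E w" "t - \<epsilon> < lambda_min E w"
proof -
  define I where "I = (INF w \<in> {w. positive_weight E w}. log_potential t w)"
  define s where "s = min 1 (\<epsilon> / (t + 1))"
  have s: "0 < s" "s \<le> 1" "(t + 1) * s \<le> \<epsilon>"
    using t \<epsilon> mult_left_mono[of s "\<epsilon> / (t + 1)" "t + 1"] by (auto simp: s_def)
  have bdd: "bdd_below (log_potential t ` {w. positive_weight E w})"
    using log_potential_nonneg[OF t _ sparse] by (intro bdd_belowI2[where m = 0]) auto
  have "(\<lambda>_. 1) \<in> {w. positive_weight E w}" by (simp add: positive_weight_def)
  then obtain w where w: "positive_weight E w" "log_potential t w < I + s\<^sup>2"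
    using cINF_less_iff[OF _ bdd, of "I + s\<^sup>2"] s unfolding I_def by auto
  have "t - \<epsilon> < q_edge E w e" if e: "e \<in> E" for e
  proof -
    let ?w = "w(e := (1 + s) * w e)"
    have "positive_weight E ?w" using w(1) s by (auto simp: positive_weight_def)
    then have "I \<le> log_potential t ?w" unfolding I_def by (intro cINF_lower[OF bdd]) simp
    also have "\<dots> \<le> log_potential t w + s * q_edge E w e - t * ln (1 + s)"
      by (rule log_potential_scale_edge[OF w(1) e s(1)])
    finally have "t * ln (1 + s) < s\<^sup>2 + s * q_edge E w e" using w(2) by linarith
    moreover have "t * (s - s\<^sup>2) \<le> t * ln (1 + s)"
      using t s by (intro mult_left_mono ln_one_plus_pos_lower_bound) auto
    ultimately have "s * (t - (t + 1) * s) < s * q_edge E w e"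
      by (simp add: algebra_simps power2_eq_square)
    then show ?thesis using s by simp
  qed
  then have "t - \<epsilon> < lambda_min E w"
    unfolding lambda_min_def using finite_E nonempty by simp
  with w(1) show ?thesis by (rule that)
qed

end

section \<open>Transport plans with prescribed support\<close>

text \<open>The common mass \<open>min (pmf \<mu> a) (pmf \<nu> a)\<close> stays where it is, and the surplus \<open>r\<close> of \<open>\<mu>\<close> over \<open>\<nu>\<close>
  is coupled independently with the surplus \<open>s\<close> of \<open>\<nu>\<close> over \<open>\<mu>\<close>; both have total mass \<open>m\<close>.\<close>

lemma exists_maximal_coupling:
  fixes \<mu> \<nu> :: "'a pmf"
  assumes fin: "finite (set_pmf \<mu>)" "finite (set_pmf \<nu>)"
  obtains \<gamma> where "map_pmf fst \<gamma> = \<mu>" "map_pmf snd \<gamma> = \<nu>"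
    "\<And>a b. (a, b) \<in> set_pmf \<gamma> \<Longrightarrow> a = b \<or> pmf \<nu> a < pmf \<mu> a \<and> pmf \<mu> b < pmf \<nu> b"
proof -
  define S where "S = set_pmf \<mu> \<union> set_pmf \<nu>"
  have finS: "finite S" using fin by (simp add: S_def)
  have sum1: "(\<Sum>a\<in>S. pmf \<mu> a) = 1" "(\<Sum>a\<in>S. pmf \<nu> a) = 1"
    using finS by (auto simp: S_def intro!: sum_pmf_eq_1)
  have zero: "pmf \<mu> a = 0" "pmf \<nu> a = 0" if "a \<notin> S" for a
    using that by (auto simp: S_def set_pmf_iff)
  define r where "r a = max 0 (pmf \<mu> a - pmf \<nu> a)" for a
  define s where "s a = max 0 (pmf \<nu> a - pmf \<mu> a)" for a
  define m where "m = (\<Sum>a\<in>S. r a)"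
  have "(\<Sum>a\<in>S. r a) - (\<Sum>a\<in>S. s a) = (\<Sum>a\<in>S. pmf \<mu> a - pmf \<nu> a)"
    unfolding sum_subtractf[symmetric] by (intro sum.cong) (auto simp: r_def s_def)
  then have m_s: "(\<Sum>a\<in>S. s a) = m" using sum1 by (simp add: m_def sum_subtractf)
  \<comment> \<open>If \<open>m = 0\<close>, then \<open>\<mu> = \<nu>\<close>, and the quotient by \<open>m\<close> in \<open>J\<close> below contributes nothing.\<close>
  have r0: "r a = 0" and s0: "s a = 0" if "m = 0" "a \<in> S" for a
    using that m_s finS sum_nonneg_eq_0_iff[of S r] sum_nonneg_eq_0_iff[of S s]
    by (auto simp: m_def r_def s_def)
  define J where
    "J = (\<lambda>(a, b). (if a = b then min (pmf \<mu> a) (pmf \<nu> a) else 0) + r a * s b / m)"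
  have "0 \<le> m" by (auto simp: m_def r_def intro: sum_nonneg)
  then have J_nonneg: "0 \<le> J p" for p by (auto simp: J_def r_def s_def split: prod.split)
  have J_row: "(\<Sum>b\<in>S. J (a, b)) = pmf \<mu> a" if "a \<in> S" for a
  proof -
    have "(\<Sum>b\<in>S. J (a, b)) = min (pmf \<mu> a) (pmf \<nu> a) + r a * (m / m)"
      using that finS
      by (simp add: J_def sum.distrib m_s flip: sum_distrib_left sum_divide_distrib)
    also have "r a * (m / m) = r a" using r0 that by (cases "m = 0") auto
    finally show ?thesis by (simp add: r_def)
  qed
  have J_col: "(\<Sum>a\<in>S. J (a, b)) = pmf \<nu> b" if "b \<in> S" for b
  proof -
    have "(\<Sum>a\<in>S. J (a, b)) = min (pmf \<mu> b) (pmf \<nu> b) + (m / m) * s b"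
      using that finS
      by (simp add: J_def sum.distrib m_def flip: sum_distrib_right sum_divide_distrib)
    also have "(m / m) * s b = s b" using s0 that by (cases "m = 0") auto
    finally show ?thesis by (simp add: s_def)
  qed
  have J_zero: "J p = 0" if "p \<notin> S \<times> S" for p
  proof -
    obtain a b where p: "p = (a, b)" by (cases p)
    with that consider "a \<notin> S" | "b \<notin> S" by blast
    then show ?thesis by cases (auto simp: p J_def r_def s_def zero)
  qed
  have "(\<integral>\<^sup>+ p. ennreal (J p) \<partial>count_space UNIV) = (\<Sum>p\<in>S \<times> S. ennreal (J p))"
    using finS J_zero by (intro nn_integral_count_space') auto
  also have "\<dots> = ennreal (\<Sum>a\<in>S. \<Sum>b\<in>S. J (a, b))"
    using J_nonneg by (simp add: sum_ennreal sum.cartesian_product)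
  also have "(\<Sum>a\<in>S. \<Sum>b\<in>S. J (a, b)) = 1" using J_row sum1 by simp
  finally have pmf_J: "pmf (embed_pmf J) p = J p" for p
    using J_nonneg by (intro pmf_embed_pmf) auto
  define \<gamma> where "\<gamma> = embed_pmf J"
  have expect: "measure_pmf.expectation \<gamma> f = (\<Sum>a\<in>S. \<Sum>b\<in>S. f (a, b) * J (a, b))"
    for f :: "'a \<times> 'a \<Rightarrow> real"
  proof -
    have "measure_pmf.expectation \<gamma> f = (\<Sum>p\<in>S \<times> S. f p * pmf \<gamma> p)"
      using finS J_zero by (intro integral_measure_pmf_real) (auto simp: set_pmf_iff \<gamma>_def pmf_J)
    then show ?thesis by (simp add: sum.cartesian_product \<gamma>_def pmf_J case_prod_unfold)
  qed
  have "map_pmf fst \<gamma> = \<mu>"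
  proof (rule pmf_eqI)
    fix c
    have "pmf (map_pmf fst \<gamma>) c = measure_pmf.expectation \<gamma> (indicator (fst -` {c}))"
      by (simp add: pmf_map)
    also have "\<dots> = (\<Sum>a\<in>S. if a = c then (\<Sum>b\<in>S. J (a, b)) else 0)"
      unfolding expect by (intro sum.cong) (auto simp: indicator_def)
    also have "\<dots> = pmf \<mu> c" using finS J_row zero by auto
    finally show "pmf (map_pmf fst \<gamma>) c = pmf \<mu> c" .
  qed
  moreover have "map_pmf snd \<gamma> = \<nu>"
  proof (rule pmf_eqI)
    fix c
    have "pmf (map_pmf snd \<gamma>) c = measure_pmf.expectation \<gamma> (indicator (snd -` {c}))"
      by (simp add: pmf_map)
    also have "\<dots> = (\<Sum>b\<in>S. \<Sum>a\<in>S. indicator (snd -` {c}) (a, b) * J (a, b))"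
      unfolding expect by (rule sum.swap)
    also have "\<dots> = (\<Sum>b\<in>S. if b = c then (\<Sum>a\<in>S. J (a, b)) else 0)"
      by (intro sum.cong) (auto simp: indicator_def)
    also have "\<dots> = pmf \<nu> c" using finS J_col zero by auto
    finally show "pmf (map_pmf snd \<gamma>) c = pmf \<nu> c" .
  qed
  moreover have "a = b \<or> pmf \<nu> a < pmf \<mu> a \<and> pmf \<mu> b < pmf \<nu> b" if "(a, b) \<in> set_pmf \<gamma>" for a b
  proof -
    have "J (a, b) \<noteq> 0" using that by (simp add: set_pmf_iff \<gamma>_def pmf_J)
    then show ?thesis by (auto simp: J_def r_def s_def max_def split: if_splits)
  qed
  ultimately show ?thesis by (rule that)
qed

text \<open>Kantorovich duality with complementary slackness: \<open>f\<close> certifies the lower bound for every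
  coupling, and the maximal coupling attains it, since it charges only the diagonal and pairs from a
  point of surplus to a point of deficit, where \<open>f\<close> drops by at least the cost.\<close>

lemma wasserstein1_eqI:
  fixes \<mu> \<nu> :: "'a pmf" and f :: "'a \<Rightarrow> real"
  assumes fin: "finite (set_pmf \<mu>)" "finite (set_pmf \<nu>)"
    and le: "\<And>a b. a \<in> set_pmf \<mu> \<Longrightarrow> b \<in> set_pmf \<nu> \<Longrightarrow> f a - f b \<le> d a b"
    and diag: "\<And>a. a \<in> set_pmf \<mu> \<Longrightarrow> d a a \<le> 0"
    and ge: "\<And>a b. pmf \<nu> a < pmf \<mu> a \<Longrightarrow> pmf \<mu> b < pmf \<nu> b \<Longrightarrow> d a b \<le> f a - f b"
  shows "wasserstein1 d \<mu> \<nu> = measure_pmf.expectation \<mu> f - measure_pmf.expectation \<nu> f"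
proof -
  let ?cost = "\<lambda>\<gamma>. measure_pmf.expectation \<gamma> (\<lambda>(a, b). d a b)"
  let ?C = "{\<gamma>. map_pmf fst \<gamma> = \<mu> \<and> map_pmf snd \<gamma> = \<nu>}"
  let ?D = "measure_pmf.expectation \<mu> f - measure_pmf.expectation \<nu> f"
  have supp: "set_pmf \<gamma> \<subseteq> set_pmf \<mu> \<times> set_pmf \<nu>" if "\<gamma> \<in> ?C" for \<gamma> using that by force
  have integrable: "integrable (measure_pmf \<gamma>) g" if "\<gamma> \<in> ?C" for \<gamma> and g :: "'a \<times> 'a \<Rightarrow> real"
    by (rule integrable_measure_pmf_finite)
      (rule finite_subset[OF supp[OF that] finite_cartesian_product[OF fin]])
  have dual: "measure_pmf.expectation \<gamma> (\<lambda>(a, b). f a - f b) = ?D" if "\<gamma> \<in> ?C" for \<gamma>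
  proof -
    have "?D = measure_pmf.expectation \<gamma> (\<lambda>p. f (fst p)) - measure_pmf.expectation \<gamma> (\<lambda>p. f (snd p))"
      using that by auto
    also have "\<dots> = measure_pmf.expectation \<gamma> (\<lambda>p. f (fst p) - f (snd p))"
      using integrable[OF that] by (intro Bochner_Integration.integral_diff[symmetric])
    finally show ?thesis by (simp add: case_prod_unfold)
  qed
  have lower: "?D \<le> ?cost \<gamma>" if "\<gamma> \<in> ?C" for \<gamma>
    unfolding dual[OF that, symmetric] using supp[OF that] le
    by (intro integral_mono_AE integrable[OF that]) (auto simp: AE_measure_pmf_iff)
  obtain \<gamma> where \<gamma>: "map_pmf fst \<gamma> = \<mu>" "map_pmf snd \<gamma> = \<nu>"
      "\<And>a b. (a, b) \<in> set_pmf \<gamma> \<Longrightarrow> a = b \<or> pmf \<nu> a < pmf \<mu> a \<and> pmf \<mu> b < pmf \<nu> b"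
    using exists_maximal_coupling[OF fin] by blast
  then have \<gamma>C: "\<gamma> \<in> ?C" by simp
  have "d a b \<le> f a - f b" if "(a, b) \<in> set_pmf \<gamma>" for a b
    using \<gamma>(3)[OF that] supp[OF \<gamma>C] that ge diag by fastforce
  then have "?cost \<gamma> \<le> ?D"
    unfolding dual[OF \<gamma>C, symmetric]
    by (intro integral_mono_AE integrable[OF \<gamma>C]) (auto simp: AE_measure_pmf_iff)
  with lower[OF \<gamma>C] have "?cost \<gamma> = ?D" by simp
  then show ?thesis
    unfolding wasserstein1_def using lower \<gamma>C by (intro cInf_eq_minimum) (auto simp: image_iff)
qed

section \<open>Curvature in graphs of girth at least six\<close>

context nonempty_connected_graph
begin

lemma graph_dist_le: "is_walk V E p \<Longrightarrow> graph_dist V E (hd p) (last p) \<le> length p - 1"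
  unfolding graph_dist_def by (rule Least_le) (auto simp: is_walk_def)

lemma graph_dist_walk:
  assumes "a \<in> V" "b \<in> V"
  obtains p where "is_walk V E p" "hd p = a" "last p = b" "length p = Suc (graph_dist V E a b)"
proof -
  obtain p where "is_walk V E p" "hd p = a" "last p = b"
    using assms connected unfolding connected_graph_def by blast
  then have "\<exists>n p. is_walk V E p \<and> hd p = a \<and> last p = b \<and> length p = Suc n"
    by (intro exI[of _ "length p - 1"] exI[of _ p]) (auto simp: is_walk_def)
  from LeastI_ex[OF this] show ?thesis using that unfolding graph_dist_def by blast
qed

lemma graph_dist_lower_bounds:
  assumes "a \<in> V" "b \<in> V"
  shows "a \<noteq> b \<Longrightarrow> 1 \<le> graph_dist V E a b"
    and "a \<noteq> b \<Longrightarrow> {a, b} \<notin> E \<Longrightarrow> 2 \<le> graph_dist V E a b"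
    and "a \<noteq> b \<Longrightarrow> {a, b} \<notin> E \<Longrightarrow> (\<And>c. {a, c} \<in> E \<Longrightarrow> {c, b} \<notin> E) \<Longrightarrow> 3 \<le> graph_dist V E a b"
proof -
  obtain p where p: "is_walk V E p" "hd p = a" "last p = b" "length p = Suc (graph_dist V E a b)"
    using assms by (rule graph_dist_walk)
  have 0: "a = b" if "graph_dist V E a b = 0"
    using p that by (auto simp: length_Suc_conv)
  have 1: "{a, b} \<in> E" if "graph_dist V E a b = 1"
    using p that by (auto simp: length_Suc_conv is_walk_def)
  have 2: "\<exists>c. {a, c} \<in> E \<and> {c, b} \<in> E" if "graph_dist V E a b = 2"
    using p that by (auto simp: length_Suc_conv is_walk_def numeral_2_eq_2)
  show "a \<noteq> b \<Longrightarrow> 1 \<le> graph_dist V E a b" using 0 by linarith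
  show two: "a \<noteq> b \<Longrightarrow> {a, b} \<notin> E \<Longrightarrow> 2 \<le> graph_dist V E a b"
    using 0 1 by (metis One_nat_def Suc_1 less_2_cases not_le)
  show "3 \<le> graph_dist V E a b"
    if "a \<noteq> b" "{a, b} \<notin> E" "\<And>c. {a, c} \<in> E \<Longrightarrow> {c, b} \<notin> E"
    using two[OF that(1,2)] 2 that(3) by fastforce
qed

lemma expectation_mu:
  assumes w: "positive_weight E w" and \<alpha>: "0 \<le> \<alpha>" "\<alpha> \<le> 1" and xy: "{x, y} \<in> E"
  shows "measure_pmf.expectation (mu E w \<alpha> x) f =
    \<alpha> * f x + (1 - \<alpha>) * ((\<Sum>z | {x, z} \<in> E. w {x, z} * f z) / wdeg E w x)"
proof -
  note pmf = pmf_mu[OF simple w \<alpha> xy]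
  have x: "x \<notin> {z. {x, z} \<in> E}" using edge_distinct by blast
  have "measure_pmf.expectation (mu E w \<alpha> x) f =
      (\<Sum>z\<in>insert x {z. {x, z} \<in> E}. f z * mu_mass E w \<alpha> x z)"
    using finite_neighbours
    by (subst integral_measure_pmf_real[of "insert x {z. {x, z} \<in> E}"])
      (auto simp: pmf set_pmf_iff mu_mass_def split: if_splits)
  also have "\<dots> = \<alpha> * f x + (\<Sum>z | {x, z} \<in> E. f z * mu_mass E w \<alpha> x z)"
    using finite_neighbours x by (simp add: mu_mass_def)
  also have "(\<Sum>z | {x, z} \<in> E. f z * mu_mass E w \<alpha> x z) =
      (\<Sum>z | {x, z} \<in> E. (1 - \<alpha>) * (w {x, z} * f z / wdeg E w x))"
    using x by (intro sum.cong) (auto simp: mu_mass_def)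
  finally show ?thesis by (simp add: sum_distrib_left sum_divide_distrib)
qed

lemma set_pmf_mu_subset:
  assumes "positive_weight E w" "0 \<le> \<alpha>" "\<alpha> \<le> 1" "{x, y} \<in> E"
  shows "set_pmf (mu E w \<alpha> x) \<subseteq> insert x {z. {x, z} \<in> E}"
  using pmf_mu[OF simple assms] by (auto simp: set_pmf_iff mu_mass_def split: if_splits)

lemma mu_mass_neighbour_le:
  assumes w: "positive_weight E w" and \<alpha>: "0 \<le> \<alpha>" "\<alpha> \<le> 1" and xy: "{x, y} \<in> E"
  shows "mu_mass E w \<alpha> x y \<le> 1 - \<alpha>"
proof -
  have "w {x, y} \<le> wdeg E w x"
    unfolding wdeg_def using xy w finite_neighbours
    by (intro member_le_sum[where f = "\<lambda>z. w {x, z}"])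
      (auto simp: positive_weight_def intro: less_imp_le)
  moreover have "0 < wdeg E w x" using wdeg_pos[OF w] edge_vertices[OF xy] by blast
  ultimately have "(1 - \<alpha>) * (w {x, y} / wdeg E w x) \<le> (1 - \<alpha>) * 1"
    using \<alpha> by (intro mult_left_mono) auto
  then show ?thesis using xy edge_distinct[OF xy] by (simp add: mu_mass_def)
qed

end

locale girth_six_graph = nonempty_connected_graph +
  assumes girth_ge: "6 \<le> girth V E"
begin

lemma cycle_length_ge: "is_cycle V E p \<Longrightarrow> 6 \<le> length p"
proof -
  assume "is_cycle V E p"
  then have "girth V E \<le> enat (length p)" unfolding girth_def by (intro INF_lower) simp
  then have "6 \<le> enat (length p)" using girth_ge by (rule order_trans[rotated])
  then show ?thesis by (simp add: numeral_eq_enat)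
qed

lemma no_triangle:
  assumes "{a, b} \<in> E" "{b, c} \<in> E"
  shows "{c, a} \<notin> E"
proof
  assume ca: "{c, a} \<in> E"
  note edges = assms ca
  have "distinct [a, b, c]" using edges[THEN edge_distinct] by auto
  then have "is_cycle V E [a, b, c]"
    using edges edges[THEN edge_vertices] by (simp add: is_cycle_def is_walk_def)
  then show False using cycle_length_ge by fastforce
qed

lemma no_quadrilateral:
  assumes "{a, b} \<in> E" "{b, c} \<in> E" "{c, d} \<in> E" "a \<noteq> c" "b \<noteq> d"
  shows "{d, a} \<notin> E"
proof
  assume da: "{d, a} \<in> E"
  note edges = assms(1-3) da
  have "distinct [a, b, c, d]" using edges[THEN edge_distinct] assms(4,5) by auto
  then have "is_cycle V E [a, b, c, d]"
    using edges edges[THEN edge_vertices] by (simp add: is_cycle_def is_walk_def)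
  then show False using cycle_length_ge by fastforce
qed

lemma no_pentagon:
  assumes "{a, b} \<in> E" "{b, c} \<in> E" "{c, d} \<in> E" "{d, e} \<in> E"
  shows "{e, a} \<notin> E"
proof
  assume ea: "{e, a} \<in> E"
  note edges = assms ea
  \<comment> \<open>Identifying two vertices at distance two along the closed walk leaves a triangle.\<close>
  have "a \<noteq> c" "b \<noteq> d" "c \<noteq> e" "d \<noteq> a" "e \<noteq> b"
    using no_triangle[of c d e] no_triangle[of d e a] no_triangle[of e a b]
      no_triangle[of a b c] no_triangle[of b c d] edges by blast+
  then have "distinct [a, b, c, d, e]" using edges[THEN edge_distinct] by auto
  then have "is_cycle V E [a, b, c, d, e]"
    using edges edges[THEN edge_vertices] by (simp add: is_cycle_def is_walk_def)
  then show False using cycle_length_ge by fastforce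
qed

text \<open>The position of a point on the paths that run from the neighbours of \<open>y\<close> through \<open>y\<close> and \<open>x\<close>
  to the neighbours of \<open>x\<close>. The default value \<open>-1\<close> is meant for the neighbours of \<open>y\<close> other than
  \<open>x\<close>, which are not adjacent to \<open>x\<close> in the absence of triangles.\<close>

definition edge_potential :: "'a \<Rightarrow> 'a \<Rightarrow> 'a \<Rightarrow> real" where
  "edge_potential x y z = (if z = x then 1 else if z = y then 0 else if {x, z} \<in> E then 2 else -1)"

text \<open>A distance too small for the potential would close a cycle of length at most 5 with the path
  through \<open>x\<close> and \<open>y\<close>.\<close>

lemma edge_potential_diff_le_dist:
  assumes xy: "{x, y} \<in> E" and a: "a \<in> insert x {z. {x, z} \<in> E}" and b: "b \<in> insert y {z. {y, z} \<in> E}"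
  shows "edge_potential x y a - edge_potential x y b \<le> real (graph_dist V E a b)"
proof -
  have V: "x \<in> V" "y \<in> V" "a \<in> V" "b \<in> V" using xy a b edge_vertices by auto
  have ne: "x \<noteq> y" using edge_distinct[OF xy] .
  note small = graph_dist_lower_bounds[OF \<open>a \<in> V\<close> \<open>b \<in> V\<close>]
  have b_far: "{x, b} \<notin> E" if "b \<noteq> y"
    using no_triangle[of x y b] xy b that edge_distinct by (auto simp: insert_commute)
  consider "a = y" | "a = x" "b = x" | "a = x" "b = y" | "a = x" "b \<noteq> x" "b \<noteq> y"
    | "a \<noteq> x" "a \<noteq> y" "b = x" | "a \<noteq> x" "a \<noteq> y" "b = y" | "a \<noteq> x" "a \<noteq> y" "b \<noteq> x" "b \<noteq> y"
    by blast
  then show ?thesis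
  proof cases
    case 1
    then show ?thesis using small(1) ne b_far by (cases "b = y") (auto simp: edge_potential_def)
  next
    case 4
    then show ?thesis using small(2) ne b_far by (auto simp: edge_potential_def)
  next
    case 6
    then have "{a, y} \<notin> E" using no_triangle[of x a y] xy a by (auto simp: insert_commute)
    then show ?thesis using 6 a small(2) by (auto simp: edge_potential_def)
  next
    case 7
    then have xa: "{x, a} \<in> E" and yb: "{y, b} \<in> E" using a b by auto
    have "a \<noteq> b" using xa b_far 7 by blast
    moreover have "{a, b} \<notin> E"
      using no_quadrilateral[of a x y b] xy xa yb 7 by (auto simp: insert_commute)
    moreover have "{c, b} \<notin> E" if "{a, c} \<in> E" for c
      using no_pentagon[of a x y b c] xy xa yb that by (auto simp: insert_commute)
    ultimately show ?thesis using small(3) 7 a b_far by (auto simp: edge_potential_def)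
  qed (use small(1) ne a in \<open>auto simp: edge_potential_def\<close>)
qed

text \<open>From the side of \<open>x\<close> to the side of \<open>y\<close>, the path through the edge \<open>xy\<close> has the length
  by which the potential drops.\<close>

lemma dist_le_edge_potential_diff:
  assumes xy: "{x, y} \<in> E" and a: "a \<in> insert x {z. {x, z} \<in> E}" "a \<noteq> y"
    and b: "b \<in> insert y {z. {y, z} \<in> E}" "b \<noteq> x"
  shows "real (graph_dist V E a b) \<le> edge_potential x y a - edge_potential x y b"
proof -
  have V: "x \<in> V" "y \<in> V" "a \<in> V" "b \<in> V" using xy a b edge_vertices by auto
  have b_far: "{x, b} \<notin> E" if "b \<noteq> y"
    using no_triangle[of x y b] xy b that edge_distinct by (auto simp: insert_commute)
  show ?thesis
    using graph_dist_le[of "[x, y]"] graph_dist_le[of "[a, x, y]"] graph_dist_le[of "[x, y, b]"]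
      graph_dist_le[of "[a, x, y, b]"] V xy a b b_far edge_distinct[OF xy]
    by (auto simp: is_walk_def edge_potential_def insert_commute)
qed

text \<open>For \<open>\<alpha> \<ge> 1/2\<close> the atom of each measure at its own centre is at least what the other measure
  puts there, so \<open>y\<close> is not a surplus point of \<open>mu E w \<alpha> x\<close>, nor \<open>x\<close> one of \<open>mu E w \<alpha> y\<close>. Hence
  all transport goes from the side of \<open>x\<close> to the side of \<open>y\<close>.\<close>

lemma kappa_alpha_eq:
  assumes w: "positive_weight E w" and xy: "{x, y} \<in> E" and \<alpha>: "1/2 \<le> \<alpha>" "\<alpha> < 1"
  shows "kappa_alpha V E w \<alpha> x y = (1 - \<alpha>) * (2 * q_edge E w {x, y} - 2)"
proof -
  have yx: "{y, x} \<in> E" using xy by (simp add: insert_commute)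
  have ne: "x \<noteq> y" using edge_distinct[OF xy] .
  have \<alpha>': "0 \<le> \<alpha>" "\<alpha> \<le> 1" using \<alpha> by auto
  let ?f = "edge_potential x y"
  note pmf_x = pmf_mu[OF simple w \<alpha>' xy] and pmf_y = pmf_mu[OF simple w \<alpha>' yx]
  note supp_x = set_pmf_mu_subset[OF w \<alpha>' xy] and supp_y = set_pmf_mu_subset[OF w \<alpha>' yx]
  have W: "wasserstein1 (\<lambda>a b. real (graph_dist V E a b)) (mu E w \<alpha> x) (mu E w \<alpha> y)
      = measure_pmf.expectation (mu E w \<alpha> x) ?f - measure_pmf.expectation (mu E w \<alpha> y) ?f"
  proof (rule wasserstein1_eqI)
    show "finite (set_pmf (mu E w \<alpha> x))" using supp_x finite_neighbours finite_subset by blast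
    show "finite (set_pmf (mu E w \<alpha> y))" using supp_y finite_neighbours finite_subset by blast
    show "?f a - ?f b \<le> real (graph_dist V E a b)"
      if "a \<in> set_pmf (mu E w \<alpha> x)" "b \<in> set_pmf (mu E w \<alpha> y)" for a b
      using that supp_x supp_y by (intro edge_potential_diff_le_dist[OF xy]) auto
    show "real (graph_dist V E a a) \<le> 0" if "a \<in> set_pmf (mu E w \<alpha> x)" for a
    proof -
      have "a \<in> V" using that supp_x edge_vertices xy by auto
      then show ?thesis using graph_dist_le[of "[a]"] by (simp add: is_walk_def)
    qed
    show "real (graph_dist V E a b) \<le> ?f a - ?f b"
      if a: "pmf (mu E w \<alpha> y) a < pmf (mu E w \<alpha> x) a"
        and b: "pmf (mu E w \<alpha> x) b < pmf (mu E w \<alpha> y) b" for a b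
    proof (rule dist_le_edge_potential_diff[OF xy])
      have "a \<in> set_pmf (mu E w \<alpha> x)" using a pmf_nonneg[of "mu E w \<alpha> y" a]
        by (auto simp: set_pmf_iff)
      then show "a \<in> insert x {z. {x, z} \<in> E}" using supp_x by blast
      have "b \<in> set_pmf (mu E w \<alpha> y)" using b pmf_nonneg[of "mu E w \<alpha> x" b]
        by (auto simp: set_pmf_iff)
      then show "b \<in> insert y {z. {y, z} \<in> E}" using supp_y by blast
      show "a \<noteq> y"
        using a mu_mass_neighbour_le[OF w \<alpha>' xy] \<alpha> by (auto simp: pmf_x pmf_y mu_mass_def[of _ _ _ y y])
      show "b \<noteq> x"
        using b mu_mass_neighbour_le[OF w \<alpha>' yx] \<alpha> by (auto simp: pmf_x pmf_y mu_mass_def[of _ _ _ x x])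
    qed
  qed
  have dx: "0 < wdeg E w x" and dy: "0 < wdeg E w y"
    using wdeg_pos[OF w] edge_vertices[OF xy] by auto
  have "(\<Sum>z | {x, z} \<in> E. w {x, z} * ?f z) =
      (\<Sum>z | {x, z} \<in> E. 2 * w {x, z} - (if z = y then 2 * w {x, y} else 0))"
    using edge_distinct ne by (intro sum.cong) (auto simp: edge_potential_def)
  also have "\<dots> = 2 * wdeg E w x - 2 * w {x, y}"
    using finite_neighbours xy by (simp add: sum_subtractf wdeg_def sum_distrib_left)
  finally have Ex: "measure_pmf.expectation (mu E w \<alpha> x) ?f =
      \<alpha> + (1 - \<alpha>) * (2 - 2 * (w {x, y} / wdeg E w x))"
    unfolding expectation_mu[OF w \<alpha>' xy] using dx by (simp add: edge_potential_def diff_divide_distrib)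
  have "{x, z} \<notin> E" if "{y, z} \<in> E" for z
    using no_triangle[OF xy that] by (simp add: insert_commute)
  then have "(\<Sum>z | {y, z} \<in> E. w {y, z} * ?f z) =
      (\<Sum>z | {y, z} \<in> E. (if z = x then 2 * w {x, y} else 0) - w {y, z})"
    using edge_distinct ne by (intro sum.cong) (auto simp: edge_potential_def insert_commute)
  also have "\<dots> = 2 * w {x, y} - wdeg E w y"
    using finite_neighbours yx by (simp add: sum_subtractf wdeg_def)
  finally have Ey: "measure_pmf.expectation (mu E w \<alpha> y) ?f =
      (1 - \<alpha>) * (2 * (w {x, y} / wdeg E w y) - 1)"
    unfolding expectation_mu[OF w \<alpha>' yx] using dy ne by (simp add: edge_potential_def diff_divide_distrib)
  show ?thesis
    unfolding kappa_alpha_def W Ex Ey q_edge_doubleton[OF xy] by (simp add: algebra_simps)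
qed

lemma kappa_LLY_eq:
  assumes "positive_weight E w" "{x, y} \<in> E"
  shows "kappa_LLY V E w x y = 2 * q_edge E w {x, y} - 2"
proof -
  have "eventually (\<lambda>\<alpha>::real. \<alpha> \<in> {1/2<..<1}) (at_left 1)"
    by (rule eventually_at_left_real) simp
  then have "eventually (\<lambda>\<alpha>. kappa_alpha V E w \<alpha> x y / (1 - \<alpha>) = 2 * q_edge E w {x, y} - 2) (at_left 1)"
    by eventually_elim (use kappa_alpha_eq[OF assms] in auto)
  then have "((\<lambda>\<alpha>. kappa_alpha V E w \<alpha> x y / (1 - \<alpha>)) \<longlongrightarrow> 2 * q_edge E w {x, y} - 2) (at_left 1)"
    by (rule tendsto_eventually)
  then show ?thesis unfolding kappa_LLY_def by (intro tendsto_Lim) auto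
qed

lemma kappa_LLY_graph_eq:
  assumes "positive_weight E w"
  shows "kappa_LLY_graph V E w = 2 * lambda_min E w - 2"
proof -
  have "{kappa_LLY V E w x y | x y. {x, y} \<in> E} = (\<lambda>q. 2 * q - 2) ` q_edge E w ` E"
  proof (intro equalityI subsetI)
    fix k assume "k \<in> (\<lambda>q. 2 * q - 2) ` q_edge E w ` E"
    then obtain e where e: "e \<in> E" "k = 2 * q_edge E w e - 2" by auto
    moreover obtain x y where "e = {x, y}" using e(1) by (rule edge_endpoints)
    ultimately have "{x, y} \<in> E \<and> k = kappa_LLY V E w x y"
      using kappa_LLY_eq[OF assms, of x y] by simp
    then show "k \<in> {kappa_LLY V E w x y | x y. {x, y} \<in> E}" by blast
  qed (use kappa_LLY_eq[OF assms] in auto)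
  moreover have "mono (\<lambda>q::real. 2 * q - 2)" by (auto intro: monoI)
  then have "2 * Min (q_edge E w ` E) - 2 = Min ((\<lambda>q. 2 * q - 2) ` q_edge E w ` E)"
    by (rule mono_Min_commute) (use finite_E nonempty in auto)
  ultimately show ?thesis
    unfolding kappa_LLY_graph_def lambda_min_def by simp
qed

lemma kappa_max_LLY_eq:
  assumes t: "0 \<le> t"
    and sparse: "\<And>F. F \<subseteq> E \<Longrightarrow> t * real (card F) \<le> real (card (\<Union>F))"
    and upper: "\<And>w. positive_weight E w \<Longrightarrow> lambda_min E w \<le> t"
  shows "kappa_max_LLY V E = 2 * t - 2"
  unfolding kappa_max_LLY_def
proof (rule cSup_eq_non_empty)
  have "positive_weight E (\<lambda>_. 1)" by (simp add: positive_weight_def)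
  then show "kappa_LLY_graph V E ` {w. positive_weight E w} \<noteq> {}" by blast
  show "k \<le> 2 * t - 2" if "k \<in> kappa_LLY_graph V E ` {w. positive_weight E w}" for k
    using that upper by (auto simp: kappa_LLY_graph_eq)
  show "2 * t - 2 \<le> b" if b: "\<And>k. k \<in> kappa_LLY_graph V E ` {w. positive_weight E w} \<Longrightarrow> k \<le> b" for b
  proof (rule field_le_epsilon)
    fix \<epsilon> :: real assume "0 < \<epsilon>"
    then obtain w where "positive_weight E w" "t - \<epsilon> / 2 < lambda_min E w"
      using exists_weight_lambda_min_gt[OF t _ sparse, of "\<epsilon> / 2"] by auto
    then show "2 * t - 2 \<le> b + \<epsilon>" using b[of "kappa_LLY_graph V E w"] by (auto simp: kappa_LLY_graph_eq)
  qed
qed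

end

section \<open>Densest cores\<close>

lemma card_edges_le_mad:
  assumes fin: "finite V" "finite E" and sub: "subgraph U F V E" and U: "U \<noteq> {}"
  shows "2 * real (card F) / real (card U) \<le> mad V E"
proof -
  let ?D = "{2 * real (card EH) / real (card VH) | VH EH. subgraph VH EH V E \<and> VH \<noteq> {}}"
  have "?D \<subseteq> (\<lambda>(VH, EH). 2 * real (card EH) / real (card VH)) ` (Pow V \<times> Pow E)"
    by (auto simp: subgraph_def)
  then have "finite ?D" by (rule finite_subset) (simp add: fin)
  then show ?thesis unfolding mad_def using sub U by (intro Max_ge) auto
qed

theorem proposition3p4:
  fixes V VH :: "'a set" and E EH :: "'a set set" and t :: real
  assumes "simple_graph V E" and "connected_graph V E" and "E \<noteq> {}"
    and "6 \<le> girth V E"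
    and "densest_core VH EH V E" and "(VH, EH) \<noteq> (V, E)"
    and "t = real (card VH) / real (card EH)"
  shows "t = 2 / mad V E \<and>
    (\<forall>w. positive_weight E w \<longrightarrow>
       0 < leakage E VH EH w \<and>
       leakage E VH EH w \<le> real (card EH) * (t - lambda_min E w)) \<and>
    (\<forall>W. maximizing_sequence V E W \<longrightarrow>
       (\<lambda>j. leakage E VH EH (W j)) \<longlonglongrightarrow> 0 \<and>
       (\<forall>e\<in>EH. (\<lambda>j. q_edge E (W j) e) \<longlonglongrightarrow> t))"
proof -
  interpret girth_six_graph V E using assms(1-4) by unfold_locales
  have core: "subgraph VH EH V E" "VH \<noteq> {}" "2 * real (card EH) / real (card VH) = mad V E"
    using assms(5) by (auto simp: densest_core_def)
  have density: "2 * real (card F) \<le> mad V E * real (card (\<Union>F))" if "F \<subseteq> E" for F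
  proof (cases "F = {}")
    case False
    have sub: "subgraph (\<Union>F) F V E"
      using that edge_subset assms(1) finite_subset[OF _ finite_V, of "\<Union>F"]
      by (auto simp: subgraph_def simple_graph_def)
    have "\<Union>F \<noteq> {}" using False that edge_endpoints by blast
    moreover have "finite (\<Union>F)" using sub by (simp add: subgraph_def simple_graph_def)
    ultimately show ?thesis
      using card_edges_le_mad[OF finite_V finite_E sub] by (simp add: pos_divide_le_eq card_gt_0_iff)
  qed simp
  have "0 < card E" using finite_E nonempty by (simp add: card_gt_0_iff)
  then have "0 < mad V E * real (card (\<Union>E))" using density[of E] by simp
  then have mad_pos: "0 < mad V E" by (simp add: zero_less_mult_iff)
  have finVH: "finite VH" and finEH: "finite EH" and EH: "EH \<subseteq> E"
    using core(1) finite_V finite_E finite_subset by (auto simp: subgraph_def)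
  have cards: "0 < card VH" "0 < card EH"
    using core(2,3) finVH finEH mad_pos by (auto simp: card_gt_0_iff)
  have t_mad: "t = 2 / mad V E" using assms(7) core(3) by (simp flip: core(3))
  have t_pos: "0 < t" and card_VH: "real (card VH) = real (card EH) * t"
    using assms(7) cards by auto
  have sparse: "t * real (card F) \<le> real (card (\<Union>F))" if "F \<subseteq> E" for F
    using density[OF that] mad_pos by (simp add: t_mad field_simps)
  have leak: "0 < leakage E VH EH w"
      "leakage E VH EH w \<le> real (card EH) * (t - lambda_min E w)" if "positive_weight E w" for w
    using leakage_pos[OF core(1,2) assms(6) that] leakage_upper_bound[OF core(1) that]
    by (simp_all add: card_VH algebra_simps)
  have lambda_le: "lambda_min E w \<le> t" if "positive_weight E w" for w
    using order.strict_trans2[OF leak[OF that]] cards by (simp add: zero_less_mult_iff)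
  have lim: "(\<lambda>j. leakage E VH EH (W j)) \<longlonglongrightarrow> 0 \<and> (\<forall>e\<in>EH. (\<lambda>j. q_edge E (W j) e) \<longlonglongrightarrow> t)"
    if "maximizing_sequence V E W" for W
  proof -
    have W: "positive_weight E (W j)" for j using that by (simp add: maximizing_sequence_def)
    have "(\<lambda>j. kappa_LLY_graph V E (W j)) \<longlonglongrightarrow> 2 * t - 2"
      using that kappa_max_LLY_eq[OF less_imp_le[OF t_pos] sparse lambda_le]
      by (simp add: maximizing_sequence_def)
    then have "(\<lambda>j. (kappa_LLY_graph V E (W j) + 2) / 2) \<longlonglongrightarrow> (2 * t - 2 + 2) / 2"
      by (intro tendsto_intros) auto
    then have lam: "(\<lambda>j. lambda_min E (W j)) \<longlonglongrightarrow> t"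
      by (simp add: kappa_LLY_graph_eq[OF W])
    then have gap: "(\<lambda>j. real (card EH) * (t - lambda_min E (W j))) \<longlonglongrightarrow> 0"
      by (auto intro!: tendsto_eq_intros)
    have "(\<lambda>j. leakage E VH EH (W j)) \<longlonglongrightarrow> 0"
      by (rule tendsto_sandwich[OF _ _ tendsto_const gap])
        (use leak[OF W] in \<open>auto intro!: always_eventually less_imp_le\<close>)
    moreover have "(\<lambda>j. q_edge E (W j) e) \<longlonglongrightarrow> t" if e: "e \<in> EH" for e
    proof (rule tendsto_sandwich[OF _ _ lam])
      show "\<forall>\<^sub>F j in sequentially. lambda_min E (W j) \<le> q_edge E (W j) e"
        using e EH lambda_min_le by auto
      have "(\<lambda>j. lambda_min E (W j) + real (card EH) * (t - lambda_min E (W j))) \<longlonglongrightarrow> t + 0"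
        by (intro tendsto_add lam gap)
      then show "(\<lambda>j. lambda_min E (W j) + real (card EH) * (t - lambda_min E (W j))) \<longlonglongrightarrow> t"
        by simp
      \<comment> \<open>One excess over the minimum is at most the sum of all of them, which the leakage identity
        bounds.\<close>
      have "q_edge E (W j) e \<le> lambda_min E (W j) + real (card EH) * (t - lambda_min E (W j))" for j
      proof -
        have "q_edge E (W j) e - lambda_min E (W j) \<le> (\<Sum>f\<in>EH. q_edge E (W j) f - lambda_min E (W j))"
          using e EH finEH lambda_min_le by (intro member_le_sum) auto
        also have "\<dots> \<le> real (card VH) - real (card EH) * lambda_min E (W j)"
          using sum_q_edge_plus_leakage[OF core(1) W, of j] leak(1)[OF W, of j]
          by (simp add: sum_subtractf)
        finally show ?thesis by (simp add: card_VH algebra_simps)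
      qed
      then show "\<forall>\<^sub>F j in sequentially. q_edge E (W j) e
          \<le> lambda_min E (W j) + real (card EH) * (t - lambda_min E (W j))" by simp
    qed
    ultimately show ?thesis by blast
  qed
  show ?thesis using t_mad leak lim by blast
qed

end
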